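(* Let $h>0$ and let $\mathbf{S}$ be any candidate order of $M\ge1$ transmitters and $N\ge 1$ receivers. Then the unique balanced spacings $\mathbf{D}_{\mathbf{S}}$ satisfying $\|H_lH_r\|=h$ minimize $Q(\overline{H_lH_r})$ among all spacings of the order $\mathbf{S}$ satisfying $\|H_lH_r\|=h$.
   Context: All points lie on a line. There are $M\ge1$ transmitters (type $T$) and $N\ge1$ receivers (type $R$), $J=M+N$, and two virtual end nodes $H_l$ (leftmost) and $H_r$ (rightmost). A (deployment) order is a sequence $\mathbf{S}=(H_l,S_1,\dots,S_J,H_r)$ where $(S_1,\dots,S_J)$ is a permutation of the set of all transmitters and receivers, listed from left to right: $0\le\|H_lS_1\|\le\cdots\le\|H_lS_J\|\le\|H_lH_r\|$. Its spacings are the nonnegative distances between neighbors, $\mathbf{D}_{\mathbf{S}}=(\|H_lS_1\|,\|S_1S_2\|,\dots,\|S_{J-1}S_J\|,\|S_JH_r\|)$; order plus spacings determine all locations. For a point $p$, $I(p)$ is the minimum of $\|T_ip\|\,\|R_jp\|$ over all transmitters $T_i$ and receivers $R_j$, and $Q(\overline{H_lH_r})=\max_{p\in\overline{H_lH_r}}I(p)$. The local vulnerable points are $H_l$, $H_r$ and the midpoints of $\overline{S_iS_{i+1}}$ for $i=1,\dots,J-1$; the local vulnerable values are the values of $I$ there. The spacings are balanced if all local vulnerable values are equal. A candidate order is an order $\mathbf{S}$ in which no block of consecutive nodes has (as sequence of node types) any of the patterns $(T,T,R,R)$, $(R,R,T,T)$, $(T,T,R,H_r)$, $(R,R,T,H_r)$,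 $(H_l,T,R,R)$, $(H_l,R,T,T)$. It is known that for a candidate order there exist unique balanced spacings with $\|H_lH_r\|=h$. *)

theory Defs
  imports "HOL-Analysis.Analysis" "HOL-Library.Sublist"
begin

datatype node = Hl | Transmitter nat | Receiver nat | Hr

datatype node_type = HL | TX | RX | HR

fun kind :: "node \<Rightarrow> node_type" where
  "kind Hl = HL"
| "kind (Transmitter _) = TX"
| "kind (Receiver _) = RX"
| "kind Hr = HR"

(* An order is the full left-to-right sequence, end nodes included, so that
   S ! 0 is the left end, S ! i is the i-th device for 1 <= i <= J = length S - 2,
   and S ! (J + 1) is the right end. *)
definition deployment_order :: "nat \<Rightarrow> nat \<Rightarrow> node list \<Rightarrow> bool" where
  "deployment_order M N S \<longleftrightarrow>
     (\<exists>P. S = Hl # P @ [Hr] \<and> distinct P \<and>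
          set P = Transmitter ` {..<M} \<union> Receiver ` {..<N})"

definition candidate_order :: "nat \<Rightarrow> nat \<Rightarrow> node list \<Rightarrow> bool" where
  "candidate_order M N S \<longleftrightarrow>
     deployment_order M N S \<and>
     (\<forall>pat \<in> {[TX, TX, RX, RX], [RX, RX, TX, TX], [TX, TX, RX, HR],
               [RX, RX, TX, HR], [HL, TX, RX, RX], [HL, RX, TX, TX]}.
        \<not> sublist pat (map kind S))"

(* D ! i is the distance between S ! i and S ! (i + 1). *)
definition spacings :: "node list \<Rightarrow> real list \<Rightarrow> bool" where
  "spacings S D \<longleftrightarrow> length D = length S - 1 \<and> (\<forall>d \<in> set D. 0 \<le> d)"

(* Coordinate of S ! i on the line, with the left end node at the origin. *)
definition location :: "real list \<Rightarrow> nat \<Rightarrow> real" where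
  "location D i = sum_list (take i D)"

definition total_length :: "real list \<Rightarrow> real" where
  "total_length D = sum_list D"

definition transmitter_indices :: "node list \<Rightarrow> nat set" where
  "transmitter_indices S = {i. i < length S \<and> kind (S ! i) = TX}"

definition receiver_indices :: "node list \<Rightarrow> nat set" where
  "receiver_indices S = {i. i < length S \<and> kind (S ! i) = RX}"

definition min_product :: "node list \<Rightarrow> real list \<Rightarrow> real \<Rightarrow> real" where
  "min_product S D p =
     Min ((\<lambda>(i, j). dist (location D i) p * dist (location D j) p) `
          (transmitter_indices S \<times> receiver_indices S))"

(* The supremum is a maximum: see vulnerability_is_max below. *)
definition vulnerability :: "node list \<Rightarrow> real list \<Rightarrow> real" where
  "vulnerability S D = (SUP p \<in> {0..total_length D}. min_product S D p)"

definition local_vulnerable_points :: "node list \<Rightarrow> real list \<Rightarrow> real set" where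
  "local_vulnerable_points S D =
     {0, total_length D} \<union>
     {midpoint (location D i) (location D (i + 1)) | i. 1 \<le> i \<and> i + 1 \<le> length S - 2}"

definition balanced :: "node list \<Rightarrow> real list \<Rightarrow> bool" where
  "balanced S D \<longleftrightarrow>
     (\<forall>p \<in> local_vulnerable_points S D. \<forall>q \<in> local_vulnerable_points S D.
        min_product S D p = min_product S D q)"

lemma indices_finite_nonempty:
  assumes "deployment_order M N S" "M \<ge> 1" "N \<ge> 1"
  shows "finite (transmitter_indices S \<times> receiver_indices S)"
    and "transmitter_indices S \<times> receiver_indices S \<noteq> {}"
proof -
  show "finite (transmitter_indices S \<times> receiver_indices S)"
    by (simp add: transmitter_indices_def receiver_indices_def)
  have "Transmitter 0 \<in> set S" "Receiver 0 \<in> set S"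
    using assms by (auto simp: deployment_order_def)
  then obtain i j where "i < length S" "S ! i = Transmitter 0" "j < length S" "S ! j = Receiver 0"
    by (metis in_set_conv_nth)
  then have "i \<in> transmitter_indices S" "j \<in> receiver_indices S"
    by (auto simp: transmitter_indices_def receiver_indices_def)
  then show "transmitter_indices S \<times> receiver_indices S \<noteq> {}"
    by blast
qed

lemma continuous_on_Min_image:
  fixes f :: "'i \<Rightarrow> real \<Rightarrow> real"
  assumes "finite A" "A \<noteq> {}" "\<And>a. a \<in> A \<Longrightarrow> continuous_on X (f a)"
  shows "continuous_on X (\<lambda>p. Min ((\<lambda>a. f a p) ` A))"
  using assms
proof (induction A rule: finite_ne_induct)
  case (insert a A)
  then show ?case
    by (simp add: continuous_on_min)
qed simp

lemma vulnerability_is_max: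
  assumes "deployment_order M N S" "M \<ge> 1" "N \<ge> 1" "spacings S D"
  shows "\<exists>p \<in> {0..total_length D}. min_product S D p = vulnerability S D"
    and "\<And>q. q \<in> {0..total_length D} \<Longrightarrow> min_product S D q \<le> vulnerability S D"
proof -
  have "continuous_on {0..total_length D} (min_product S D)"
    unfolding min_product_def case_prod_beta
    by (intro continuous_on_Min_image indices_finite_nonempty[OF assms(1-3)] continuous_intros)
  moreover have "0 \<le> total_length D"
    using assms(4) by (auto simp: spacings_def total_length_def intro: sum_list_nonneg)
  ultimately obtain p where p: "p \<in> {0..total_length D}"
    "\<forall>q \<in> {0..total_length D}. min_product S D q \<le> min_product S D p"
    using continuous_attains_sup[of "{0..total_length D}" "min_product S D"] by auto
  then have "vulnerability S D = min_product S D p"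
    unfolding vulnerability_def by (intro cSup_eq_maximum) auto
  with p show "\<exists>p \<in> {0..total_length D}. min_product S D p = vulnerability S D"
    and "\<And>q. q \<in> {0..total_length D} \<Longrightarrow> min_product S D q \<le> vulnerability S D"
    by auto
qed

end

(* For every order the maximum of I is attained at a local vulnerable point, so balanced
   spacings have Q equal to the common value v. Suppose other spacings of the same length
   have all local vulnerable values below v, and let e i be the displacement of the i-th node.
   A gap between nodes of different types has value (gap / 2)^2, so it shrinks. A gap between
   nodes i and i + 1 of the same type either shrinks, or the stretch from the nearest node r of
   the other type to the left up to i + 1 shrinks, or the stretch from i to the nearest node r
   of the other type on the right does: if x (x + a) decreases while x grows, then a + 2 x
   decreases. Walking to the right along such stretches keeps e negative and below its
   value at the nearest node of the other type on the left. When a stretch jumps over a run to r,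
   the candidate condition makes the gap after r mixed, so the walk resumes at r + 1 with
   the invariant intact. At the last device the invariant says that both factors of
   the value at H_r have grown, a contradiction. Only for two devices can the first jump, from
   H_l, end at the last device; that case is a direct computation. *)

theory Submission
  imports Defs
begin

section \<open>Elementary inequalities for gaps and products of distances\<close>

text \<open>If \<open>a' + d'\<close> had not dropped, then \<open>a' >= a + d - d'\<close>, and
  inserting this bound makes the new product exceed the old one by at least
  \<open>(d' / 2 - d / 2) * (a + d / 2 - d' / 2)\<close>. This is nonnegative unless
  \<open>d' > 2 * a + d\<close>; then \<open>d' / 2\<close> alone already exceeds
  \<open>d / 2 + a\<close>. Here \<open>d\<close> is a gap between nodes of one type and
  \<open>a\<close> the distance from it to the nearest node of the other type on one side.\<close>

lemma add_less_of_half_mult_less: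
  fixes a d a' d' :: real
  assumes "0 \<le> a" "0 \<le> d" "0 \<le> a'" "d \<le> d'"
    and "d' / 2 * (d' / 2 + a') < d / 2 * (d / 2 + a)"
  shows "a' + d' < a + d"
proof (rule ccontr)
  assume "\<not> a' + d' < a + d"
  then have "d' / 2 * (d / 2 + a + (d / 2 - d' / 2)) \<le> d' / 2 * (d' / 2 + a')"
    using assms by (intro mult_left_mono) auto
  moreover have "d / 2 * (d / 2 + a) \<le> d' / 2 * (d / 2 + a + (d / 2 - d' / 2))" if "d' \<le> 2 * a + d"
  proof -
    have "0 \<le> (d' / 2 - d / 2) * (a + d / 2 - d' / 2)"
      using that assms by (intro mult_nonneg_nonneg) auto
    then show ?thesis by (simp add: algebra_simps)
  qed
  moreover have "d / 2 * (d / 2 + a) \<le> d' / 2 * (d' / 2 + a')" if "2 * a + d < d'"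
    using that assms by (intro mult_mono) auto
  ultimately show False using assms(5) by linarith
qed

text \<open>Beyond the midpoint the parabola \<open>(d - u) * (u + a)\<close> is past its vertex
  \<open>(d - a) / 2\<close>; before the midpoint both factors are increasing in \<open>u\<close>.
  The product is that of the nearer end of a gap of length \<open>d\<close> and a node at distance
  \<open>a\<close> beyond its left end, seen from the point at offset \<open>u\<close>.\<close>

lemma min_mult_le_half:
  fixes d a u :: real
  assumes "0 \<le> a" "0 \<le> u" "u \<le> d"
  shows "min u (d - u) * (u + a) \<le> d / 2 * (d / 2 + a)"
proof (cases "u \<le> d / 2")
  case True
  then show ?thesis using assms by (intro mult_mono) auto
next
  case False
  have "(d - u) * (u + a) = d / 2 * (d / 2 + a) - (u - d / 2)\<^sup>2 - a * (u - d / 2)"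
    by (simp add: algebra_simps power2_eq_square)
  moreover have "0 \<le> a * (u - d / 2)"
    using False assms by simp
  ultimately have "(d - u) * (u + a) \<le> d / 2 * (d / 2 + a)"
    using zero_le_power2[of "u - d / 2"] by linarith
  then show ?thesis using False by (simp add: min_def)
qed

text \<open>Each of the \<open>J + 1\<close> gaps gets exactly one point: number \<open>i\<close>
  lies in the gap from \<open>x i\<close> to \<open>x (Suc i)\<close>. The two outer gaps use the
  end node in place of the midpoint.\<close>

definition vulnerable_point :: "nat \<Rightarrow> (nat \<Rightarrow> real) \<Rightarrow> nat \<Rightarrow> real" where
  "vulnerable_point J x i =
     (if i = 0 then x 0 else if i = J then x (Suc J) else midpoint (x i) (x (Suc i)))"

text \<open>Monotonicity keeps every node out of the interior of the gap. This bounds both factors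
  of any product at a midpoint from below.\<close>

lemma half_gap_le_dist_midpoint:
  fixes x :: "nat \<Rightarrow> real"
  assumes "mono x"
  shows "(x (Suc i) - x i) / 2 \<le> \<bar>x a - midpoint (x i) (x (Suc i))\<bar>"
proof (cases "a \<le> i")
  case True
  then have "x a \<le> x i" "x i \<le> x (Suc i)" using assms by (auto intro: monoD)
  then show ?thesis by (simp add: midpoint_def field_simps)
next
  case False
  then have "x (Suc i) \<le> x a" "x i \<le> x (Suc i)" using assms by (auto intro: monoD)
  then show ?thesis by (simp add: midpoint_def field_simps)
qed

text \<open>The identity \<open>(a + b)^2 = 4 * a * b + (b - a)^2\<close> and its mirror image give
  \<open>8 * v\<close> as a lower bound for the squares of \<open>a + b\<close> and
  \<open>2 * h - (a + b)\<close>, one of which is at most \<open>h\<close>; hence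
  \<open>8 * v <= h^2\<close>. For the other positions one of the two sums is at least
  \<open>h\<close>; its square is at least \<open>8 * v\<close> while the gap contributes less than
  \<open>4 * v\<close>, so the product at that end exceeds \<open>v\<close>.\<close>

lemma two_node_bound:
  fixes a b a' b' h v :: real
  assumes "0 \<le> a" "a \<le> b" "b \<le> h" "0 \<le> a'" "a' \<le> b'" "b' \<le> h"
    and v: "v \<le> a * b" "v \<le> (h - a) * (h - b)" "v \<le> ((b - a) / 2)\<^sup>2"
    and "((b' - a') / 2)\<^sup>2 < v"
  shows "v \<le> a' * b' \<or> v \<le> (h - a') * (h - b')"
proof -
  have "8 * v \<le> (a + b)\<^sup>2" "8 * v \<le> (2 * h - (a + b))\<^sup>2"
    using v by (auto simp: power2_eq_square field_simps)
  moreover have "(a + b)\<^sup>2 \<le> h\<^sup>2 \<or> (2 * h - (a + b))\<^sup>2 \<le> h\<^sup>2"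
  proof (cases "a + b \<le> h")
    case True then show ?thesis using assms by (intro disjI1 power_mono) auto
  next
    case False then show ?thesis using assms by (intro disjI2 power_mono) auto
  qed
  ultimately have h: "8 * v \<le> h\<^sup>2" by linarith
  show ?thesis
  proof (cases "h \<le> a' + b'")
    case True
    then have "h\<^sup>2 \<le> (a' + b')\<^sup>2" using assms by (intro power_mono) auto
    moreover have "(a' + b')\<^sup>2 = 4 * (a' * b') + 4 * ((b' - a') / 2)\<^sup>2"
      by (simp add: power2_eq_square field_simps)
    ultimately show ?thesis using h assms(10) by linarith
  next
    case False
    then have "h\<^sup>2 \<le> (2 * h - (a' + b'))\<^sup>2" using assms by (intro power_mono) auto
    moreover have "(2 * h - (a' + b'))\<^sup>2 = 4 * ((h - a') * (h - b')) + 4 * ((b' - a') / 2)\<^sup>2"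
      by (simp add: power2_eq_square field_simps)
    ultimately show ?thesis using h assms(10) by linarith
  qed
qed

section \<open>Runs of one colour, and the walk along displaced nodes\<close>

lemma first_other_colour:
  fixes c :: "nat \<Rightarrow> bool"
  assumes "i < b" "c b \<noteq> c i"
  obtains r where "i < r" "r \<le> b" "c r \<noteq> c i" "\<And>k. i \<le> k \<Longrightarrow> k < r \<Longrightarrow> c k = c i"
proof -
  define r where "r = (LEAST r. i < r \<and> c r \<noteq> c i)"
  have "i < r \<and> c r \<noteq> c i" unfolding r_def by (rule LeastI[of _ b]) (use assms in auto)
  moreover have "r \<le> b" unfolding r_def by (rule Least_le) (use assms in auto)
  moreover have "c k = c i" if "i \<le> k" "k < r" for k
    using not_less_Least[of k "\<lambda>r. i < r \<and> c r \<noteq> c i"] that unfolding r_def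
    by (cases "k = i") auto
  ultimately show thesis using that by blast
qed

lemma last_other_colour:
  fixes c :: "nat \<Rightarrow> bool"
  assumes "b < i" "c b \<noteq> c i"
  obtains r where "b \<le> r" "r < i" "c r \<noteq> c i" "\<And>k. r < k \<Longrightarrow> k \<le> i \<Longrightarrow> c k = c i"
proof -
  define r where "r = (GREATEST r. r < i \<and> c r \<noteq> c i)"
  have "r < i \<and> c r \<noteq> c i" unfolding r_def by (rule GreatestI_nat[of _ b i]) (use assms in auto)
  moreover have "b \<le> r" unfolding r_def by (rule Greatest_le_nat[of _ _ i]) (use assms in auto)
  moreover have "c k = c i" if "r < k" "k \<le> i" for k
    using Greatest_le_nat[of "\<lambda>r. r < i \<and> c r \<noteq> c i" k i] that unfolding r_def
    by (cases "k = i") (auto simp: not_le)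
  ultimately show thesis using that by blast
qed

text \<open>The colour \<open>c i\<close> tells whether the \<open>i\<close>-th device is a transmitter. The six
  forbidden patterns pair up under exchange of the two types, and the three pairs are
  \<open>run_run\<close>, \<open>run_end\<close> and \<open>start_run\<close>.\<close>

lemma no_uniform_improvement:
  fixes c :: "nat \<Rightarrow> bool" and x y :: "nat \<Rightarrow> real" and J :: nat
  assumes "2 \<le> J" "mono x" "mono y" "x 0 = y 0" "x (Suc J) = y (Suc J)"
    and run_run: "\<And>i. 1 \<le> i \<Longrightarrow> i + 3 \<le> J \<Longrightarrow> c i = c (i + 1) \<Longrightarrow> c (i + 2) \<noteq> c (i + 1)
                 \<Longrightarrow> c (i + 3) \<noteq> c (i + 2)"
    and run_end: "\<And>i. 1 \<le> i \<Longrightarrow> i + 2 = J \<Longrightarrow> c i = c (i + 1) \<Longrightarrow> c (i + 2) = c (i + 1)"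
    and start_run: "3 \<le> J \<Longrightarrow> c 1 \<noteq> c 2 \<Longrightarrow> c 3 \<noteq> c 2"
    and lower: "\<And>i a b. i \<le> J \<Longrightarrow> a \<in> {1..J} \<Longrightarrow> b \<in> {1..J} \<Longrightarrow> c a \<noteq> c b \<Longrightarrow>
          v \<le> \<bar>x a - vulnerable_point J x i\<bar> * \<bar>x b - vulnerable_point J x i\<bar>"
    and upper: "\<And>i. i \<le> J \<Longrightarrow> \<exists>a \<in> {1..J}. \<exists>b \<in> {1..J}. c a \<noteq> c b \<and>
          \<bar>y a - vulnerable_point J y i\<bar> * \<bar>y b - vulnerable_point J y i\<bar> < v"
  shows False
proof -
  define e where "e i = y i - x i" for i
  \<comment> \<open>The bounds \<open>1 \<le> r\<close> here and \<open>r \<le> J\<close> in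
    \<open>right\<close> keep out the end nodes, whose value under \<open>c\<close> carries no
    meaning.\<close>
  define left where "left r i \<longleftrightarrow> 1 \<le> r \<and> r < i \<and> c r \<noteq> c i \<and> (\<forall>k. r < k \<longrightarrow> k \<le> i \<longrightarrow> c k = c i)" for r i
  define right where "right r i \<longleftrightarrow> i < r \<and> r \<le> J \<and> c r \<noteq> c i \<and> (\<forall>k. i \<le> k \<longrightarrow> k < r \<longrightarrow> c k = c i)" for r i
  note le_x = monoD[OF \<open>mono x\<close>] and le_y = monoD[OF \<open>mono y\<close>]
  \<comment> \<open>Products are symmetric, so the pair can be swapped to let \<open>a\<close> carry
    a prescribed colour.\<close>
  have upper': "\<exists>a \<in> {1..J}. \<exists>b \<in> {1..J}. c a = c k \<and> c b \<noteq> c k \<and>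
          \<bar>y a - vulnerable_point J y i\<bar> * \<bar>y b - vulnerable_point J y i\<bar> < v" if "i \<le> J" for i k
    using upper[OF that] by (metis mult.commute)
  have mixed: "e (Suc i) < e i" if i: "1 \<le> i" "i < J" "c i \<noteq> c (Suc i)" for i
  proof -
    have square: "u < w" if "u * u < w * w" "0 \<le> w" for u w :: real
      using that by (intro power2_less_imp_less[of u w]) (simp_all add: power2_eq_square)
    obtain a b where ab: "\<bar>y a - midpoint (y i) (y (Suc i))\<bar> * \<bar>y b - midpoint (y i) (y (Suc i))\<bar> < v"
      using upper[of i] i by (auto simp: vulnerable_point_def)
    \<comment> \<open>The low pair for \<open>y\<close> may be any pair; its factors are still at
      least half the gap. For \<open>x\<close> the two ends of the gap themselves are
      tested.\<close>
    have "((y (Suc i) - y i) / 2) * ((y (Suc i) - y i) / 2)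
        \<le> \<bar>y a - midpoint (y i) (y (Suc i))\<bar> * \<bar>y b - midpoint (y i) (y (Suc i))\<bar>"
      using le_y[of i "Suc i"] by (intro mult_mono half_gap_le_dist_midpoint \<open>mono y\<close>) auto
    also have "\<dots> < v" by (fact ab)
    also have "v \<le> \<bar>x i - midpoint (x i) (x (Suc i))\<bar> * \<bar>x (Suc i) - midpoint (x i) (x (Suc i))\<bar>"
      using lower[of i i "Suc i"] i by (auto simp: vulnerable_point_def)
    also have "\<dots> = ((x (Suc i) - x i) / 2) * ((x (Suc i) - x i) / 2)"
      using le_x[of i "Suc i"] by (simp add: midpoint_def abs_if field_simps)
    finally have "(y (Suc i) - y i) / 2 < (x (Suc i) - x i) / 2"
      by (rule square) (use le_x[of i "Suc i"] in simp)
    then show ?thesis by (simp add: e_def)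
  qed
  have same: "e (Suc i) < e i \<or> (\<exists>r. left r i \<and> e (Suc i) < e r) \<or> (\<exists>r. right r i \<and> e r < e i)"
    if i: "1 \<le> i" "i < J" "c i = c (Suc i)" for i
  proof -
    define d d' m m' where "d = x (Suc i) - x i" and "d' = y (Suc i) - y i"
      and "m = midpoint (x i) (x (Suc i))" and "m' = midpoint (y i) (y (Suc i))"
    have d: "0 \<le> d" "0 \<le> d'" using le_x[of i "Suc i"] le_y[of i "Suc i"] by (auto simp: d_def d'_def)
    have m: "m = x i + d / 2" "m' = y i + d' / 2"
      by (auto simp: m_def m'_def d_def d'_def midpoint_def field_simps)
    have vp: "vulnerable_point J y i = m'" using i by (simp add: vulnerable_point_def m'_def)
    obtain a b where ab: "a \<in> {1..J}" "b \<in> {1..J}" "c b \<noteq> c i" "\<bar>y a - m'\<bar> * \<bar>y b - m'\<bar> < v"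
      using upper'[of i i] i vp by (metis less_imp_le)
    have "d' / 2 * \<bar>y b - m'\<bar> \<le> \<bar>y a - m'\<bar> * \<bar>y b - m'\<bar>"
      unfolding d'_def m'_def by (intro mult_right_mono half_gap_le_dist_midpoint \<open>mono y\<close>) auto
    with ab have b: "d' / 2 * \<bar>y b - m'\<bar> < v" by linarith
    have v: "v \<le> \<bar>x i - m\<bar> * \<bar>x r - m\<bar>" if "r \<in> {1..J}" "c r \<noteq> c i" for r
      using lower[of i i r] i that by (auto simp: vulnerable_point_def m_def)
    show ?thesis
    proof (cases "d' < d")
      case True
      then show ?thesis by (simp add: e_def d_def d'_def)
    next
      case False
      \<comment> \<open>Both ends of the gap have the colour of \<open>i\<close>, so
        \<open>b\<close> lies outside it, and its side decides between the second and third
        alternative. Replacing \<open>b\<close> by the nearest device \<open>r\<close> of another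
        colour on that side only lowers the product for \<open>y\<close>.\<close>
      consider "b < i" | "Suc i < b" using ab i by (metis linorder_neqE_nat less_SucE)
      then show ?thesis
      proof cases
        case 1
        obtain r where r: "b \<le> r" "r < i" "c r \<noteq> c i" and run: "\<And>k. r < k \<Longrightarrow> k \<le> i \<Longrightarrow> c k = c i"
          using last_other_colour[of b i c] 1 ab by metis
        have o: "y b \<le> y r" "y r \<le> y i" "x r \<le> x i" using r by (auto intro: le_x le_y)
        have "d' / 2 * (d' / 2 + (y i - y r)) \<le> d' / 2 * \<bar>y b - m'\<bar>"
          using o d by (intro mult_left_mono) (auto simp: m)
        also have "\<dots> < v" by (fact b)
        also have "v \<le> \<bar>x i - m\<bar> * \<bar>x r - m\<bar>" using v[of r] r ab i by auto
        also have "\<dots> = d / 2 * (d / 2 + (x i - x r))"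
          using o d by (simp add: m)
        finally have "(y i - y r) + d' < (x i - x r) + d"
          by (rule add_less_of_half_mult_less[rotated -1]) (use False o d in auto)
        then have "e (Suc i) < e r" by (simp add: e_def d_def d'_def)
        moreover have "left r i" unfolding left_def
          by (intro conjI allI impI run) (use r ab in auto)
        ultimately show ?thesis by blast
      next
        case 2
        obtain r where r: "i < r" "r \<le> b" "c r \<noteq> c i" and run: "\<And>k. i \<le> k \<Longrightarrow> k < r \<Longrightarrow> c k = c i"
          using first_other_colour[of i b c] 2 ab by (metis Suc_lessD)
        have "Suc i < r" using r(1,3) i by (metis Suc_lessI)
        then have o: "y r \<le> y b" "y (Suc i) \<le> y r" "x (Suc i) \<le> x r" using r by (auto intro: le_x le_y)
        have "d' / 2 * (d' / 2 + (y r - y (Suc i))) \<le> d' / 2 * \<bar>y b - m'\<bar>"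
          using o d by (intro mult_left_mono) (auto simp: m'_def midpoint_def d'_def field_simps)
        also have "\<dots> < v" by (fact b)
        also have "v \<le> \<bar>x i - m\<bar> * \<bar>x r - m\<bar>" using v[of r] r ab i by auto
        also have "\<dots> = d / 2 * (d / 2 + (x r - x (Suc i)))"
          using o d by (simp add: m) (simp add: d_def field_simps)
        finally have "(y r - y (Suc i)) + d' < (x r - x (Suc i)) + d"
          by (rule add_less_of_half_mult_less[rotated -1]) (use False o d in auto)
        then have "e r < e i" by (simp add: e_def d_def d'_def)
        moreover have "right r i" unfolding right_def
          by (intro conjI allI impI run) (use r ab in auto)
        ultimately show ?thesis by blast
      qed
    qed
  qed
  \<comment> \<open>The invariant of the walk. At most one \<open>r\<close> satisfies
    \<open>left r i\<close>; if there is none, only \<open>e i < 0\<close> remains. The part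
    \<open>e r < 0\<close> is what the argument at the last device uses.\<close>
  define ahead where "ahead i \<longleftrightarrow> e i < 0 \<and> (\<forall>r. left r i \<longrightarrow> e i < e r \<and> e r < 0)" for i
  \<comment> \<open>Across a mixed gap the nearest other colour to the left is \<open>i\<close>
    itself, so \<open>e i < 0\<close> alone restores the full invariant. This lets the walk resume
    after a jump.\<close>
  have after_mixed: "ahead (Suc i)" if "1 \<le> i" "i < J" "c i \<noteq> c (Suc i)" "e i < 0" for i
  proof -
    have "r = i" if "left r (Suc i)" for r
      using that \<open>c i \<noteq> c (Suc i)\<close> unfolding left_def by (metis le_SucI less_Suc_eq order_refl)
    then show ?thesis using mixed[of i] that unfolding ahead_def by force
  qed
  have not_ahead: "\<not> ahead i" if "1 \<le> i" "i \<le> J" for i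
    using that
  \<comment> \<open>Strong induction, since a jump continues at \<open>Suc r\<close>, possibly many
    devices further on.\<close>
  proof (induction "J - i" arbitrary: i rule: less_induct)
    case less
    show ?case
    proof
      assume A: "ahead i"
      show False
      proof (cases "i = J")
        case True
        have vp: "vulnerable_point J y J = y (Suc J)" using \<open>2 \<le> J\<close> by (simp add: vulnerable_point_def)
        obtain a b where ab: "a \<in> {1..J}" "b \<in> {1..J}" "c b \<noteq> c J"
          "\<bar>y a - y (Suc J)\<bar> * \<bar>y b - y (Suc J)\<bar> < v"
          using upper'[of J J] vp by (metis order_refl)
        then have "b < J" by (metis atLeastAtMost_iff le_neq_implies_less)
        then obtain r where r: "b \<le> r" "r < J" "c r \<noteq> c J" and tail: "\<And>k. r < k \<Longrightarrow> k \<le> J \<Longrightarrow> c k = c J"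
          using last_other_colour[of b J c] ab by metis
        have "left r i" unfolding left_def True
          by (intro conjI allI impI tail) (use r ab in auto)
        then have neg: "e i < 0" "e r < 0" using A by (auto simp: ahead_def)
        have o: "y a \<le> y J" "y J \<le> y (Suc J)" "y b \<le> y r" "y r \<le> y (Suc J)" "x r \<le> x (Suc J)" "x J \<le> x (Suc J)"
          using r ab by (auto intro: le_x le_y)
        \<comment> \<open>Passing from \<open>a\<close>, \<open>b\<close> to \<open>J\<close>,
          \<open>r\<close> only shortens the distances to the right end. Since \<open>J\<close> and
          \<open>r\<close> have moved left and the end is fixed, even these are larger than
          before.\<close>
        have "(x (Suc J) - x J) * (x (Suc J) - x r) \<le> (y (Suc J) - y a) * (y (Suc J) - y b)"
          using o neg assms(5) True by (intro mult_mono) (auto simp: e_def)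
        also have "\<dots> = \<bar>y a - y (Suc J)\<bar> * \<bar>y b - y (Suc J)\<bar>"
          using o by simp
        also have "\<dots> < v" by (fact ab)
        also have "v \<le> \<bar>x J - x (Suc J)\<bar> * \<bar>x r - x (Suc J)\<bar>"
          using lower[of J J r] r ab \<open>2 \<le> J\<close> by (auto simp: vulnerable_point_def)
        finally show False using o by simp
      next
        case False
        then have "i < J" using less by auto
        have next_ahead: "\<not> ahead (Suc i)" using less \<open>i < J\<close> by auto
        show False
        proof (cases "c i = c (Suc i)")
          case True
          \<comment> \<open>Neighbours of equal colour share their nearest other colour on the left,
            so the comparison with \<open>e r\<close> carries over.\<close>
          have run: "left r i" if "left r (Suc i)" for r
            using that True unfolding left_def by (metis le_SucI less_SucE)
          consider "e (Suc i) < e i" | r where "left r i" "e (Suc i) < e r"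
            | r where "right r i" "e r < e i"
            using same[OF less.prems(1) \<open>i < J\<close> True] by blast
          then show False
          proof cases
            case 1
            then show False using A next_ahead run unfolding ahead_def by fastforce
          next
            case (2 r)
            have "q = r" if "left q i" for q
              using that 2(1) unfolding left_def by (metis linorder_neqE_nat order_less_imp_le)
            moreover have "e r < 0" using A 2(1) by (simp add: ahead_def)
            ultimately have "ahead (Suc i)" unfolding ahead_def using 2(2) run by fastforce
            then show False using next_ahead by contradiction
          next
            case (3 r)
            then have r: "i < r" "r \<le> J" "c r \<noteq> c i" and run_r: "\<And>k. i \<le> k \<Longrightarrow> k < r \<Longrightarrow> c k = c i"
              unfolding right_def by blast+
            then have "Suc i < r" using True by (metis Suc_lessI)
            \<comment> \<open>Devices \<open>k\<close> and \<open>k + 1\<close> are the last two of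
              the run before \<open>r\<close>: \<open>run_end\<close> excludes \<open>r = J\<close>,
              and \<open>run_run\<close> makes the gap after \<open>r\<close> mixed.\<close>
            then obtain k where k: "r = k + 2" "i \<le> k"
              using that[of "r - 2"] by auto
            have ck: "c k = c (k + 1)" "c (k + 2) \<noteq> c (k + 1)"
              using r(3) run_r[of k] run_r[of "k + 1"] k by auto
            then have "r \<noteq> J" using run_end[of k] k less.prems by auto
            then have "r < J" using r by auto
            moreover have "c (k + 3) \<noteq> c (k + 2)"
              using run_run[of k] ck k \<open>r < J\<close> less.prems by auto
            then have "c r \<noteq> c (Suc r)" using k by (simp add: numeral_3_eq_3)
            moreover have "e r < 0" using 3 A by (auto simp: ahead_def)
            ultimately have "ahead (Suc r)" using r less.prems by (intro after_mixed) auto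
            then show False using less.hyps[of "Suc r"] r \<open>r < J\<close> by auto
          qed
        next
          case False
          then show False using after_mixed[of i] A next_ahead less.prems \<open>i < J\<close> 
            by (auto simp: ahead_def)
        qed
      qed
    qed
  qed
  have "\<not> left r 1" for r by (auto simp: left_def)
  \<comment> \<open>At device 1 the second half of \<open>ahead\<close> is vacuous, so its failure
    says that this device has not moved left.\<close>
  then have e1: "0 \<le> e 1" using not_ahead[of 1] \<open>2 \<le> J\<close> by (force simp: ahead_def)
  have vp: "vulnerable_point J y 0 = y 0" by (simp add: vulnerable_point_def)
  obtain a b where ab: "a \<in> {1..J}" "b \<in> {1..J}" "c b \<noteq> c 1" "\<bar>y a - y 0\<bar> * \<bar>y b - y 0\<bar> < v"
    using upper'[of 0 1] vp by (metis zero_le)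
  then have "1 < b" by (metis atLeastAtMost_iff le_neq_implies_less)
  then obtain r where r: "1 < r" "r \<le> b" "c r \<noteq> c 1" and run_r: "\<And>k. 1 \<le> k \<Longrightarrow> k < r \<Longrightarrow> c k = c 1"
    using first_other_colour[of 1 b c] ab by metis
  \<comment> \<open>Otherwise neither 1 nor \<open>r\<close> has moved left, and no pair could have
    a product below \<open>v\<close> at the left end.\<close>
  have er: "e r < 0"
  proof (rule ccontr)
    assume "\<not> e r < 0"
    have o: "y 0 \<le> y a" "y 1 \<le> y a" "y 0 \<le> y b" "y r \<le> y b" "x 0 \<le> x r" "x 0 \<le> x 1"
      using r ab by (auto intro: le_x le_y)
    have "v \<le> (x 1 - x 0) * (x r - x 0)"
      using lower[of 0 1 r] r ab o by (auto simp: vulnerable_point_def)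
    also have "\<dots> \<le> \<bar>y a - y 0\<bar> * \<bar>y b - y 0\<bar>"
      using o e1 \<open>\<not> e r < 0\<close> assms(4) by (intro mult_mono) (auto simp: e_def)
    finally show False using ab by auto
  qed
  show False
  proof (cases "r < J")
    case True
    \<comment> \<open>For \<open>r = 2\<close> the relevant pattern begins at the left end node; for
      larger \<open>r\<close> it begins at device \<open>r - 2\<close>, inside the first
      run.\<close>
    have "c r \<noteq> c (Suc r)"
    proof (cases "r = 2")
      case True
      then show ?thesis using start_run r \<open>r < J\<close> by (auto simp: numeral_3_eq_3)
    next
      case False
      then obtain k where k: "r = k + 2" "1 \<le> k"
        using r that[of "r - 2"] by force
      then have "c k = c (k + 1)" "c (k + 2) \<noteq> c (k + 1)"
        using r(3) run_r[of k] run_r[of "k + 1"] by auto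
      then have "c (k + 3) \<noteq> c (k + 2)" using run_run[of k] k True by auto
      then show ?thesis using k by (simp add: numeral_3_eq_3)
    qed
    then have "ahead (Suc r)" using True r er by (intro after_mixed) auto
    then show False using not_ahead[of "Suc r"] True by auto
  next
    case False
    then have "r = J" using r ab by auto
    \<comment> \<open>A run of two or more devices followed by a single last device contradicts
      \<open>run_end\<close>.\<close>
    have "J = 2"
    proof (rule ccontr)
      assume "J \<noteq> 2"
      then obtain k where k: "J = k + 2" "1 \<le> k"
        using \<open>2 \<le> J\<close> that[of "J - 2"] by force
      then show False using run_end[of k] r(3) run_r[of k] run_r[of "k + 1"] \<open>r = J\<close> by auto
    qed
    \<comment> \<open>Positions relative to the common left end, to match
      \<open>two_node_bound\<close> with \<open>h = X 3\<close>.\<close>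
    define X Y where "X i = x i - x 0" and "Y i = y i - y 0" for i
    have c12: "c 1 \<noteq> c 2" using r \<open>r = J\<close> \<open>J = 2\<close> by auto
    have o: "x 0 \<le> x 1" "x 1 \<le> x 2" "x 2 \<le> x 3" "y 0 \<le> y 1" "y 1 \<le> y 2" "y 2 \<le> y 3"
      by (auto intro: le_x le_y)
    have vp: "vulnerable_point J z 0 = z 0" "vulnerable_point J z 1 = (z 1 + z 2) / 2"
        "vulnerable_point J z 2 = z 3" for z
      using \<open>J = 2\<close> by (simp_all add: vulnerable_point_def midpoint_def numeral_2_eq_2 numeral_3_eq_3)
    have gap: "\<bar>z 1 - (z 1 + z 2) / 2\<bar> * \<bar>z 2 - (z 1 + z 2) / 2\<bar> = ((z 2 - z 1) / 2)\<^sup>2"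
      for z :: "nat \<Rightarrow> real"
    proof -
      have *: "z 1 - (z 1 + z 2) / 2 = - ((z 2 - z 1) / 2)" "z 2 - (z 1 + z 2) / 2 = (z 2 - z 1) / 2"
        by (simp_all add: field_simps)
      show ?thesis unfolding * by (simp only: abs_minus_cancel) (simp add: power2_eq_square)
    qed
    have low: "v \<le> \<bar>x 1 - vulnerable_point J x i\<bar> * \<bar>x 2 - vulnerable_point J x i\<bar>" if "i \<le> 2" for i
      using lower[of i 1 2] that \<open>J = 2\<close> c12 by simp
    have L: "v \<le> X 1 * X 2" "v \<le> (X 3 - X 1) * (X 3 - X 2)" "v \<le> ((X 2 - X 1) / 2)\<^sup>2"
      using low[of 0] low[of 2] low[of 1] o unfolding vp gap by (simp_all add: X_def)
    have val: "\<bar>y 1 - vulnerable_point J y i\<bar> * \<bar>y 2 - vulnerable_point J y i\<bar> < v" if i: "i \<le> 2" for i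
    proof -
      obtain a b where *: "a \<in> {1..J}" "b \<in> {1..J}" "c a = c 1" "c b \<noteq> c 1"
          "\<bar>y a - vulnerable_point J y i\<bar> * \<bar>y b - vulnerable_point J y i\<bar> < v"
        using upper'[of i 1] i \<open>J = 2\<close> by blast
      moreover have "a = 1 \<or> a = 2" "b = 1 \<or> b = 2"
        using * \<open>J = 2\<close> by auto
      ultimately show ?thesis using c12 by auto
    qed
    have YL: "Y 1 * Y 2 < v" "(Y 3 - Y 1) * (Y 3 - Y 2) < v" "((Y 2 - Y 1) / 2)\<^sup>2 < v"
      using val[of 0] val[of 2] val[of 1] o unfolding vp gap by (simp_all add: Y_def)
    have Y3: "Y 3 = X 3" using assms(4,5) \<open>J = 2\<close> by (simp add: X_def Y_def numeral_3_eq_3)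
    have ord: "0 \<le> X 1" "X 1 \<le> X 2" "X 2 \<le> X 3" "0 \<le> Y 1" "Y 1 \<le> Y 2" "Y 2 \<le> X 3"
      using o Y3 unfolding X_def Y_def by linarith+
    show False
      using two_node_bound[OF ord L YL(3)] YL(1,2) unfolding Y3 by linarith
  qed
qed

section \<open>Reduction of the maximum to the local vulnerable points\<close>

lemma gap_containing_point:
  fixes x :: "nat \<Rightarrow> 'a :: linorder"
  assumes "x 0 \<le> p" "p \<le> x (Suc n)"
  obtains i where "i \<le> n" "x i \<le> p" "p \<le> x (Suc i)"
  using assms
proof (induction n arbitrary: thesis)
  case (Suc n)
  show ?case
  proof (cases "p \<le> x (Suc n)")
    case True
    then show ?thesis using Suc.IH[OF _ Suc.prems(2) True] Suc.prems(1) by force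
  next
    case False
    then show ?thesis using Suc.prems by (intro Suc.prems(1)[of "Suc n"]) auto
  qed
qed auto

text \<open>In an outer gap, leaving the end node brings every device closer, so the same pair
  serves. In a mixed gap its two ends serve, as \<open>u * (d - u)\<close> peaks at the midpoint. In
  a gap of one colour the end nearer to \<open>p\<close> is paired with whichever of
  \<open>a\<close>, \<open>b\<close> has the other colour.\<close>

lemma product_le_at_vulnerable_point:
  fixes c :: "nat \<Rightarrow> bool" and x :: "nat \<Rightarrow> real"
  assumes "mono x" "2 \<le> J" "i \<le> J" and p: "x i \<le> p" "p \<le> x (Suc i)"
    and ab: "a \<in> {1..J}" "b \<in> {1..J}" "c a \<noteq> c b"
  shows "\<exists>a' \<in> {1..J}. \<exists>b' \<in> {1..J}. c a' \<noteq> c b' \<and> \<bar>x a' - p\<bar> * \<bar>x b' - p\<bar>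
           \<le> \<bar>x a - vulnerable_point J x i\<bar> * \<bar>x b - vulnerable_point J x i\<bar>"
proof -
  note le_x = monoD[OF \<open>mono x\<close>]
  consider "i = 0" | "i = J" | "0 < i" "i < J" using assms by linarith
  then show ?thesis
  proof cases
    case 1
    have "x (Suc 0) \<le> x a" "x (Suc 0) \<le> x b" using ab by (auto intro: le_x)
    then have "\<bar>x a - p\<bar> * \<bar>x b - p\<bar> \<le> \<bar>x a - x 0\<bar> * \<bar>x b - x 0\<bar>"
      using 1 p by (intro mult_mono) auto
    moreover have "vulnerable_point J x i = x 0" using 1 by (simp add: vulnerable_point_def)
    ultimately show ?thesis using ab by metis
  next
    case 2
    have "x a \<le> x J" "x b \<le> x J" using ab by (auto intro: le_x)
    then have "\<bar>x a - p\<bar> * \<bar>x b - p\<bar> \<le> \<bar>x a - x (Suc J)\<bar> * \<bar>x b - x (Suc J)\<bar>"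
      using 2 p by (intro mult_mono) auto
    moreover have "vulnerable_point J x i = x (Suc J)" using 2 assms by (simp add: vulnerable_point_def)
    ultimately show ?thesis using ab by metis
  next
    case 3
    define d u m where "d = x (Suc i) - x i" and "u = p - x i"
      and "m = midpoint (x i) (x (Suc i))"
    have vp: "vulnerable_point J x i = m" using 3 by (simp add: vulnerable_point_def m_def)
    have u: "0 \<le> u" "u \<le> d" using p by (auto simp: u_def d_def)
    have m: "m = x i + d / 2" by (simp add: m_def d_def midpoint_def field_simps)
    have far: "d / 2 \<le> \<bar>x k - m\<bar>" for k
      unfolding d_def m_def by (rule half_gap_le_dist_midpoint[OF \<open>mono x\<close>])
    show ?thesis
    proof (cases "c i = c (Suc i)")
      case False
      have "u * (d - u) = d / 2 * (d / 2) - (u - d / 2)\<^sup>2"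
        by (simp add: power2_eq_square algebra_simps)
      then have "u * (d - u) \<le> d / 2 * (d / 2)" by simp
      also have "\<dots> \<le> \<bar>x a - m\<bar> * \<bar>x b - m\<bar>" using far u by (intro mult_mono) auto
      also have "u * (d - u) = \<bar>x i - p\<bar> * \<bar>x (Suc i) - p\<bar>" using p by (simp add: u_def d_def)
      finally have "\<bar>x i - p\<bar> * \<bar>x (Suc i) - p\<bar> \<le> \<bar>x a - m\<bar> * \<bar>x b - m\<bar>" .
      moreover have "i \<in> {1..J}" "Suc i \<in> {1..J}" using 3 by auto
      ultimately show ?thesis using False vp by metis
    next
      case True
      obtain q r where qr: "r \<in> {1..J}" "c r \<noteq> c i"
        "\<bar>x q - m\<bar> * \<bar>x r - m\<bar> = \<bar>x a - m\<bar> * \<bar>x b - m\<bar>"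
        using ab by (metis mult.commute)
      define k where "k = (if u \<le> d - u then i else Suc i)"
      have k: "\<bar>x k - p\<bar> = min u (d - u)" using p by (auto simp: k_def u_def d_def)
      have "min u (d - u) * \<bar>x r - p\<bar> \<le> d / 2 * \<bar>x r - m\<bar>"
      proof (cases "r \<le> i")
        case True
        then have "x r \<le> x i" by (rule le_x)
        moreover from this have "\<bar>x r - m\<bar> = d / 2 + (x i - x r)" "\<bar>x r - p\<bar> = u + (x i - x r)"
          using u p by (auto simp: m u_def)
        ultimately show ?thesis using min_mult_le_half[of "x i - x r" u d] u by simp
      next
        case False
        then have "x (Suc i) \<le> x r" by (intro le_x) auto
        moreover from this have "\<bar>x r - m\<bar> = d / 2 + (x r - x (Suc i))"
          "\<bar>x r - p\<bar> = d - u + (x r - x (Suc i))"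
          using u p by (auto simp: m u_def d_def field_simps)
        \<comment> \<open>The mirror image of the previous case, with offsets measured from the
          right end of the gap.\<close>
        ultimately show ?thesis using min_mult_le_half[of "x r - x (Suc i)" "d - u" d] u
          by (simp add: min.commute)
      qed
      also have "\<dots> \<le> \<bar>x q - m\<bar> * \<bar>x r - m\<bar>" using far by (intro mult_right_mono) auto
      finally have "\<bar>x k - p\<bar> * \<bar>x r - p\<bar> \<le> \<bar>x a - m\<bar> * \<bar>x b - m\<bar>" by (simp add: k qr)
      moreover have "k \<in> {1..J}" "c k \<noteq> c r" using qr True 3 by (auto simp: k_def)
      ultimately show ?thesis using qr vp by blast
    qed
  qed
qed

section \<open>Translation from node lists to coordinates and colours\<close>

lemma mono_location:
  assumes "spacings S D"
  shows "mono (location D)"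
proof (rule monoI)
  fix i j :: nat
  assume "i \<le> j"
  then have "take j D = take i D @ take (j - i) (drop i D)"
    by (metis le_add_diff_inverse take_add)
  moreover have "0 \<le> sum_list (take (j - i) (drop i D))"
    using assms by (auto simp: spacings_def intro!: sum_list_nonneg dest!: in_set_takeD in_set_dropD)
  ultimately show "location D i \<le> location D j" by (simp add: location_def)
qed

text \<open>The end nodes count as not transmitting, just like receivers; hence the explicit index
  range \<open>{1..length S - 2}\<close> in the lemmas below.\<close>

abbreviation transmits :: "node list \<Rightarrow> nat \<Rightarrow> bool" where
  "transmits S i \<equiv> kind (S ! i) = TX"

lemma deployment_order_kinds:
  assumes "deployment_order M N S"
  shows "2 \<le> length S" "kind (S ! 0) = HL" "kind (S ! (length S - 1)) = HR"
    and "i \<in> {1..length S - 2} \<Longrightarrow> kind (S ! i) \<in> {TX, RX}"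
proof -
  obtain P where P: "S = Hl # P @ [Hr]" "set P = Transmitter ` {..<M} \<union> Receiver ` {..<N}"
    using assms by (auto simp: deployment_order_def)
  show "2 \<le> length S" "kind (S ! 0) = HL" "kind (S ! (length S - 1)) = HR"
    by (simp_all add: P nth_append)
  assume "i \<in> {1..length S - 2}"
  then have "S ! i \<in> set P" using P(1) by (cases i) (auto simp: nth_append)
  then show "kind (S ! i) \<in> {TX, RX}" using P(2) by auto
qed

lemma device_indices:
  assumes "deployment_order M N S"
  shows "transmitter_indices S = {i \<in> {1..length S - 2}. transmits S i}"
    and "receiver_indices S = {i \<in> {1..length S - 2}. \<not> transmits S i}"
proof -
  note K = deployment_order_kinds[OF assms]
  have "i \<in> {1..length S - 2}" if "i < length S" "kind (S ! i) \<in> {TX, RX}" for i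
    using that K(1-3) by (cases "i = 0 \<or> i = length S - 1") auto
  moreover have "i < length S" "kind (S ! i) \<noteq> TX \<longleftrightarrow> kind (S ! i) = RX"
    if "i \<in> {1..length S - 2}" for i
    using that K(1) K(4)[OF that] by auto
  ultimately show "transmitter_indices S = {i \<in> {1..length S - 2}. transmits S i}"
    and "receiver_indices S = {i \<in> {1..length S - 2}. \<not> transmits S i}"
    unfolding transmitter_indices_def receiver_indices_def by blast+
qed

lemma min_product_le:
  assumes "deployment_order M N S"
    and ab: "a \<in> {1..length S - 2}" "b \<in> {1..length S - 2}" "transmits S a \<noteq> transmits S b"
  shows "min_product S D p \<le> \<bar>location D a - p\<bar> * \<bar>location D b - p\<bar>"
proof -
  have *: "min_product S D p \<le> \<bar>location D i - p\<bar> * \<bar>location D j - p\<bar>"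
    if "i \<in> transmitter_indices S" "j \<in> receiver_indices S" for i j
    unfolding min_product_def using that
    by (intro Min_le) (auto simp: dist_real_def transmitter_indices_def receiver_indices_def
        intro!: rev_image_eqI[of "(i, j)"])
  show ?thesis
  proof (cases "transmits S a")
    case True
    then show ?thesis using *[of a b] ab device_indices[OF assms(1)] by auto
  next
    case False
    then show ?thesis using *[of b a] ab device_indices[OF assms(1)] by (auto simp: mult.commute)
  qed
qed

lemma min_product_attained:
  assumes "deployment_order M N S" "M \<ge> 1" "N \<ge> 1"
  obtains a b where "a \<in> {1..length S - 2}" "b \<in> {1..length S - 2}"
    "transmits S a \<noteq> transmits S b"
    "min_product S D p = \<bar>location D a - p\<bar> * \<bar>location D b - p\<bar>"
proof -
  have "min_product S D p \<in> (\<lambda>(i, j). dist (location D i) p * dist (location D j) p) `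
          (transmitter_indices S \<times> receiver_indices S)"
    unfolding min_product_def using indices_finite_nonempty[OF assms] by (intro Min_in) auto
  then show thesis using that device_indices[OF assms(1)] by (auto simp: dist_real_def)
qed

lemma sublist_of_four:
  assumes "i + 3 < length L"
  shows "sublist [L ! i, L ! (i + 1), L ! (i + 2), L ! (i + 3)] L"
proof -
  have "take 4 (drop i L) = [L ! i, L ! (i + 1), L ! (i + 2), L ! (i + 3)]"
    using assms by (intro nth_equalityI) (auto simp: less_Suc_eq numeral_eq_Suc)
  then show ?thesis by (metis sublist_def append_take_drop_id)
qed

lemma vulnerable_point_in_local_vulnerable_points:
  assumes "spacings S D" "i \<le> length S - 2" "2 \<le> length S"
  shows "vulnerable_point (length S - 2) (location D) i \<in> local_vulnerable_points S D"
proof -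
  have "length D = Suc (length S - 2)" using assms by (simp add: spacings_def)
  then have "location D (Suc (length S - 2)) = total_length D"
    by (simp add: location_def total_length_def)
  then show ?thesis using assms
    by (auto simp: vulnerable_point_def local_vulnerable_points_def location_def)
qed

theorem theorem3:
  fixes M N :: nat and h :: real and S :: "node list" and D :: "real list"
  assumes "M \<ge> 1" and "N \<ge> 1" and "h > 0"
    and "candidate_order M N S"
    and "spacings S D" and "total_length D = h" and "balanced S D"
  shows "is_arg_min (vulnerability S) (\<lambda>D'. spacings S D' \<and> total_length D' = h) D"
proof -
  \<comment> \<open>The left end node has coordinate 0, so the common balanced value
    \<open>v\<close> is read off there.\<close>
  define J c v where "J = length S - 2" and "c = transmits S" and "v = min_product S D 0"
  have dep: "deployment_order M N S" using assms by (simp add: candidate_order_def)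
  note K = deployment_order_kinds[OF dep]
  have len: "length S = J + 2" using K by (simp add: J_def)
  have kind: "kind (S ! i) = (if c i then TX else RX)" if "1 \<le> i" "i \<le> J" for i
    using K(4)[of i] that by (auto simp: J_def c_def)
  have ends: "kind (S ! 0) = HL" "kind (S ! (J + 1)) = HR" using K by (simp_all add: len)
  have le: "min_product S E p \<le> \<bar>location E a - p\<bar> * \<bar>location E b - p\<bar>"
    if "a \<in> {1..J}" "b \<in> {1..J}" "c a \<noteq> c b" for E a b p
    using min_product_le[OF dep] that by (simp add: J_def c_def)
  have attained: "\<exists>a \<in> {1..J}. \<exists>b \<in> {1..J}. c a \<noteq> c b \<and>
      min_product S E p = \<bar>location E a - p\<bar> * \<bar>location E b - p\<bar>" for E p
    using min_product_attained[OF dep assms(1,2), of E p] unfolding J_def c_def by metis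
  have "2 \<le> J"
  proof -
    obtain a b where "a \<in> {1..J}" "b \<in> {1..J}" "c a \<noteq> c b" using attained by blast
    then have "a \<noteq> b" "1 \<le> a" "1 \<le> b" "a \<le> J" "b \<le> J" by auto
    then show ?thesis by linarith
  qed
  have loc: "location E 0 = 0" "location E (Suc J) = total_length E" if "spacings S E" for E
    using that len by (simp_all add: location_def total_length_def spacings_def)
  have lvp: "vulnerable_point J (location E) i \<in> local_vulnerable_points S E"
    if "spacings S E" "i \<le> J" for E i
    using vulnerable_point_in_local_vulnerable_points[OF that(1), of i] that(2) len
    unfolding J_def[symmetric] by simp
  have "vulnerable_point J (location D) 0 = 0" by (simp add: vulnerable_point_def location_def)
  then have "0 \<in> local_vulnerable_points S D" using lvp[OF assms(5), of 0] by simp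
  then have v: "min_product S D (vulnerable_point J (location D) i) = v" if "i \<le> J" for i
    using assms(7) lvp[OF assms(5) that] unfolding balanced_def v_def by blast
  have upper: "vulnerability S D \<le> v"
  proof -
    obtain p where p: "p \<in> {0..total_length D}" "min_product S D p = vulnerability S D"
      using vulnerability_is_max(1)[OF dep assms(1,2,5)] by blast
    obtain i where i: "i \<le> J" "location D i \<le> p" "p \<le> location D (Suc i)"
      using gap_containing_point[of "location D" p J] p loc[OF assms(5)] by auto
    define q where "q = vulnerable_point J (location D) i"
    obtain a b where ab: "a \<in> {1..J}" "b \<in> {1..J}" "c a \<noteq> c b"
      "min_product S D q = \<bar>location D a - q\<bar> * \<bar>location D b - q\<bar>"
      using attained by blast
    obtain a' b' where a': "a' \<in> {1..J}" "b' \<in> {1..J}" "c a' \<noteq> c b'"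
      "\<bar>location D a' - p\<bar> * \<bar>location D b' - p\<bar> \<le> min_product S D q"
      using product_le_at_vulnerable_point[OF mono_location[OF assms(5)] \<open>2 \<le> J\<close> i ab(1-3),
          folded q_def, folded ab(4)] by blast
    then have "min_product S D p \<le> min_product S D q" using le[OF a'(1-3), of D p] by linarith
    then show ?thesis using p v[OF i(1)] by (simp add: q_def)
  qed
  \<comment> \<open>All six forbidden patterns have length four, so windows of four nodes cover
    every case.\<close>
  have pat: "[kind (S ! i), kind (S ! (i + 1)), kind (S ! (i + 2)), kind (S ! (i + 3))] \<notin>
      {[TX, TX, RX, RX], [RX, RX, TX, TX], [TX, TX, RX, HR],
       [RX, RX, TX, HR], [HL, TX, RX, RX], [HL, RX, TX, TX]}" if "i + 3 < length S" for i
    using sublist_of_four[of i "map kind S"] that assms(4) unfolding candidate_order_def by force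
  have "v \<le> vulnerability S E" if E: "spacings S E" "total_length E = h" for E
  proof (rule ccontr)
    assume less: "\<not> v \<le> vulnerability S E"
    note mono = mono_location[OF assms(5)] mono_location[OF E(1)]
    show False
    proof (rule no_uniform_improvement[OF \<open>2 \<le> J\<close> mono, where c = c and v = v])
      show "location D 0 = location E 0" "location D (Suc J) = location E (Suc J)"
        using loc assms(5,6) E by simp_all
    next
      fix i
      assume "1 \<le> i" "i + 3 \<le> J" "c i = c (i + 1)" "c (i + 2) \<noteq> c (i + 1)"
      then show "c (i + 3) \<noteq> c (i + 2)"
        using pat[of i] kind[of i] kind[of "i + 1"] kind[of "i + 2"] kind[of "i + 3"] len
        by (auto split: if_splits)
    next
      fix i
      assume "1 \<le> i" "i + 2 = J" "c i = c (i + 1)"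
      then show "c (i + 2) = c (i + 1)"
        \<comment> \<open>With \<open>i + 2 = J\<close> the fourth node of the window is
          \<open>S ! (J + 1)\<close>, the right end.\<close>
        using pat[of i] kind[of i] kind[of "i + 1"] kind[of "i + 2"] ends(2) len
        by (auto split: if_splits simp: numeral_3_eq_3)
    next
      assume "3 \<le> J" "c 1 \<noteq> c 2"
      then show "c 3 \<noteq> c 2"
        using pat[of 0] kind[of 1] kind[of 2] kind[of 3] ends(1) len
        by (auto split: if_splits simp flip: numeral_2_eq_2)
    next
      fix i a b
      assume "i \<le> J" "a \<in> {1..J}" "b \<in> {1..J}" "c a \<noteq> c b"
      then show "v \<le> \<bar>location D a - vulnerable_point J (location D) i\<bar> *
          \<bar>location D b - vulnerable_point J (location D) i\<bar>"
        using le v by metis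
    next
      fix i
      assume i: "i \<le> J"
      define q where "q = vulnerable_point J (location E) i"
      \<comment> \<open>Only points of the segment are bounded by \<open>vulnerability S E\<close>,
        which is below \<open>v\<close> by assumption.\<close>
      have "q \<in> {0..total_length E}"
        using monoD[OF mono(2), of 0 i] monoD[OF mono(2), of i "Suc i"]
          monoD[OF mono(2), of "Suc i" "Suc J"] loc[OF E(1)] i
        by (auto simp: q_def vulnerable_point_def midpoint_def field_simps)
      then have "min_product S E q < v"
        using vulnerability_is_max(2)[OF dep assms(1,2) E(1)] less by fastforce
      then show "\<exists>a \<in> {1..J}. \<exists>b \<in> {1..J}. c a \<noteq> c b \<and>
          \<bar>location E a - vulnerable_point J (location E) i\<bar> *
          \<bar>location E b - vulnerable_point J (location E) i\<bar> < v"
        using attained[of E q] by (metis q_def)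
    qed
  qed
  then show ?thesis using upper assms(5,6) by (force simp: is_arg_min_def)
qed

end
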